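(* Let $f:\mathbb{R}^n\to\mathbb{R}\cup\{+\infty\}$ be proper, lower semicontinuous and convex, and $A\in\mathbb{R}^{m\times n}$. For $b\in\mathbb{R}^m$ let $X=X(b)$ be the set of minimizers over $x\in\mathbb{R}^n$ of $f(x)+\frac12\|Ax-b\|^2$. Then $X(b)\neq\varnothing$ for every $b\in\mathbb{R}^m$: (i) if and only if $\operatorname{dom}\mathcal T=\operatorname{ran}(I_m+A\triangleright\partial f)=\mathbb{R}^m$, where $\mathcal T=(\partial f+A^\top A)^{-1}\circ A^\top$; (ii) if and only if $\operatorname{ran}(\partial f+A^\top A)\supseteq\operatorname{ran}A^\top$; (iii) if and only if $A\circ\partial f^*\circ A^\top:\mathbb{R}^m\to2^{\mathbb{R}^m}$ is maximally monotone; (iv) if $0\in\operatorname{ri}(\operatorname{ran}\partial f-\operatorname{ran}A^\top)$, or equivalently, $(\operatorname{ri}\operatorname{ran}\partial f)\cap\operatorname{ran}A^\top\neq\varnothing$; (v) if $0\in\operatorname{ri}\operatorname{ran}\partial f$.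
   Context: $f^*$ is the convex conjugate, $\partial$ the convex subdifferential, $\operatorname{ri}$ the relative interior, $I_m$ the $m\times m$ identity. For a set-valued operator $\mathcal B$: $\operatorname{dom}\mathcal B=\{x:\mathcal B(x)\neq\varnothing\}$, $\operatorname{ran}\mathcal B=\bigcup_x\mathcal B(x)$, and $\mathcal B^{-1}$ is its set-valued inverse. The parallel composition is $A\triangleright\partial f=(A\circ(\partial f)^{-1}\circ A^\top)^{-1}=(A\circ\partial f^*\circ A^\top)^{-1}$. *)

theory Defs
  imports "HOL-Analysis.Analysis"
begin

definition proper_fun :: "('a \<Rightarrow> ereal) \<Rightarrow> bool" where
  "proper_fun f \<longleftrightarrow> (\<forall>x. f x \<noteq> -\<infinity>) \<and> (\<exists>x. f x \<noteq> \<infinity>)"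

definition lsc_fun :: "('a::topological_space \<Rightarrow> ereal) \<Rightarrow> bool" where
  "lsc_fun f \<longleftrightarrow> (\<forall>x. f x \<le> Liminf (at x) f)"

text \<open>Only meaningful for functions that avoid \<open>-\<infinity>\<close>, since \<open>\<infinity> + (-\<infinity>) = \<infinity>\<close> on type \<open>ereal\<close>.\<close>

definition convex_fun :: "('a::real_vector \<Rightarrow> ereal) \<Rightarrow> bool" where
  "convex_fun f \<longleftrightarrow> (\<forall>x y. \<forall>t::real. 0 < t \<and> t < 1 \<longrightarrow>
     f ((1 - t) *\<^sub>R x + t *\<^sub>R y) \<le> ereal (1 - t) * f x + ereal t * f y)"

definition conjugate :: "('a::real_inner \<Rightarrow> ereal) \<Rightarrow> 'a \<Rightarrow> ereal" where
  "conjugate f v = (SUP x. ereal (v \<bullet> x) - f x)"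

text \<open>For proper \<open>f\<close> the subdifferential is empty wherever \<open>f x = \<infinity>\<close>, as the inequality then
  fails at any \<open>y\<close> with \<open>f y < \<infinity>\<close>.\<close>

definition subdifferential :: "('a::real_inner \<Rightarrow> ereal) \<Rightarrow> 'a \<Rightarrow> 'a set" where
  "subdifferential f x = {v. \<forall>y. f x + ereal (v \<bullet> (y - x)) \<le> f y}"

definition op_dom :: "('a \<Rightarrow> 'b set) \<Rightarrow> 'a set" where
  "op_dom B = {x. B x \<noteq> {}}"

definition op_ran :: "('a \<Rightarrow> 'b set) \<Rightarrow> 'b set" where
  "op_ran B = (\<Union>x. B x)"

definition op_inv :: "('a \<Rightarrow> 'b set) \<Rightarrow> 'b \<Rightarrow> 'a set" where
  "op_inv B u = {x. u \<in> B x}"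

definition op_comp :: "('b \<Rightarrow> 'c set) \<Rightarrow> ('a \<Rightarrow> 'b set) \<Rightarrow> 'a \<Rightarrow> 'c set" (infixr "\<circ>\<^sub>o" 75) where
  "(B \<circ>\<^sub>o C) x = (\<Union>u\<in>C x. B u)"

definition op_add :: "('a \<Rightarrow> 'b::plus set) \<Rightarrow> ('a \<Rightarrow> 'b set) \<Rightarrow> 'a \<Rightarrow> 'b set" (infixl "+\<^sub>o" 65) where
  "(B +\<^sub>o C) x = {u + v | u v. u \<in> B x \<and> v \<in> C x}"

definition mat_op :: "real^'n^'m \<Rightarrow> real^'n \<Rightarrow> (real^'m) set" where
  "mat_op A x = {A *v x}"

definition parallel_comp ::
    "real^'n^'m \<Rightarrow> (real^'n \<Rightarrow> (real^'n) set) \<Rightarrow> real^'m \<Rightarrow> (real^'m) set" where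
  "parallel_comp A B = op_inv (mat_op A \<circ>\<^sub>o op_inv B \<circ>\<^sub>o mat_op (transpose A))"

definition monotone_op :: "('a::real_inner \<Rightarrow> 'a set) \<Rightarrow> bool" where
  "monotone_op B \<longleftrightarrow> (\<forall>x y. \<forall>u\<in>B x. \<forall>v\<in>B y. 0 \<le> (x - y) \<bullet> (u - v))"

definition maximally_monotone :: "('a::real_inner \<Rightarrow> 'a set) \<Rightarrow> bool" where
  "maximally_monotone B \<longleftrightarrow>
     monotone_op B \<and> (\<forall>C. monotone_op C \<and> (\<forall>x. B x \<subseteq> C x) \<longrightarrow> C = B)"

definition minimizers :: "(real^'n \<Rightarrow> ereal) \<Rightarrow> real^'n^'m \<Rightarrow> real^'m \<Rightarrow> (real^'n) set" where
  "minimizers f A b =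
     {x. is_arg_min (\<lambda>z. f z + ereal (1 / 2 * (norm (A *v z - b))\<^sup>2)) (\<lambda>_. True) x}"

definition solution_op :: "(real^'n \<Rightarrow> ereal) \<Rightarrow> real^'n^'m \<Rightarrow> real^'m \<Rightarrow> (real^'n) set" where
  "solution_op f A =
     op_inv (subdifferential f +\<^sub>o mat_op (transpose A ** A)) \<circ>\<^sub>o mat_op (transpose A)"

end

theory Submission
  imports Defs
begin

text \<open>
Stationarity characterizes the minimizers: \<open>x\<close> minimizes \<open>f x + 1 / 2 * (norm (A x - b))\<^sup>2\<close> iff
\<open>A\<^sup>T (b - A x) \<in> \<partial>f x\<close>. Unfolding the set-valued compositions, solvability of this inclusion in
\<open>x\<close> is membership of \<open>b\<close> in the domain of the solution operator, membership of \<open>b\<close> in the range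
of \<open>I + A \<triangleright> \<partial>f\<close>, and membership of \<open>A\<^sup>T b\<close> in the range of \<open>\<partial>f + A\<^sup>T A\<close>. With \<open>y = b - A x\<close> it
also says \<open>b - y \<in> M y\<close> for \<open>M = A \<circ> \<partial>f\<^sup>* \<circ> A\<^sup>T\<close>, because \<open>\<partial>f\<^sup>*\<close> inverts \<open>\<partial>f\<close>
(\<open>op_inv_subdifferential\<close>).

Everything else rests on existence of minimizers. A proper lower semicontinuous convex function has
a lower bound of linear growth (\<open>convex_lsc_linear_lower_bound\<close>), so adding a positive definite
quadratic makes it attain its minimum. Hence the resolvent of a subdifferential is total
(\<open>subdifferential_resolvent_total\<close>).

For maximal monotonicity, \<open>M\<close> is monotone, and a monotone operator with total resolvent is maximal
(\<open>maximally_monotone_if_resolvent_total\<close>). Conversely \<open>M\<close> is contained in the subdifferential of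
\<open>f\<^sup>* \<circ> A\<^sup>T\<close>; if \<open>M\<close> is maximal, it equals this subdifferential, whose resolvent is total
(\<open>maximally_monotone_comp_iff\<close>).

For the sufficient conditions, Tikhonov regularized problems have minimizers, and a relative
interior condition on \<open>dom f\<^sup>* + ran A\<^sup>T\<close> keeps them bounded as the regularization vanishes
(\<open>minimizer_exists_if_rel_interior\<close>). The same result for the zero map shows that every point in
the relative interior of \<open>dom f\<^sup>*\<close> is a subgradient of \<open>f\<close>. Thus \<open>ran \<partial>f\<close> lies between the convex
set \<open>dom f\<^sup>*\<close> and its relative interior, has the same relative interior, and obeys the calculus of
relative interiors of convex sets; this turns \<open>0 \<in> ri (ran \<partial>f - ran A\<^sup>T)\<close> into the intersection
condition.
\<close>

section \<open>Lower semicontinuity and existence of minimizers\<close>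

lemma lsc_fun_iff_open: "lsc_fun f \<longleftrightarrow> (\<forall>c. open {x. c < f x})"
proof -
  have "lsc_fun f \<longleftrightarrow> (\<forall>x c. c < f x \<longrightarrow> eventually (\<lambda>y. c < f y) (nhds x))"
    unfolding lsc_fun_def le_Liminf_iff eventually_nhds_conv_at by blast
  also have "\<dots> \<longleftrightarrow> (\<forall>c. open {x. c < f x})"
    by (subst open_subopen) (auto simp: eventually_nhds subset_eq)
  finally show ?thesis .
qed

lemma lsc_fun_limit:
  fixes f :: "'a::topological_space \<Rightarrow> ereal"
  assumes lsc: "lsc_fun f" and X: "X \<longlonglongrightarrow> x" and r: "r \<longlonglongrightarrow> \<rho>"
    and le: "\<And>n. f (X n) \<le> ereal (r n)"
  shows "f x \<le> ereal \<rho>"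
proof (rule ccontr)
  assume "\<not> f x \<le> ereal \<rho>"
  then have "ereal \<rho> < f x" by simp
  then obtain d where d: "ereal \<rho> < ereal d" "ereal d < f x"
    using ereal_dense2 by blast
  have "open {x. ereal d < f x}"
    using lsc lsc_fun_iff_open by blast
  then have "eventually (\<lambda>n. X n \<in> {x. ereal d < f x}) sequentially"
    using X d topological_tendstoD by blast
  moreover have "eventually (\<lambda>n. r n < d) sequentially"
    using r d order_tendstoD(2) by fastforce
  ultimately have "eventually (\<lambda>n. False) sequentially"
    by eventually_elim (use le in \<open>metis ereal_less_eq(3) linorder_not_less mem_Collect_eq order.strict_trans2 order_less_imp_le\<close>)
  then show False by simp
qed

lemma bounded_subseq_limit:
  fixes X :: "nat \<Rightarrow> 'a::heine_borel"
  assumes "bounded (range X)"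
  obtains x \<sigma> where "strict_mono (\<sigma> :: nat \<Rightarrow> nat)" "(X \<circ> \<sigma>) \<longlonglongrightarrow> x"
  using bounded_imp_convergent_subsequence[OF assms] by blast

text \<open>The direct method: a cluster point of an asymptotically minimizing sequence is a minimizer.\<close>

lemma minimizer_of_bounded_minimizing_seq:
  fixes f :: "'a::euclidean_space \<Rightarrow> ereal" and q :: "'a \<Rightarrow> real"
  assumes proper: "proper_fun f" and lsc: "lsc_fun f" and q: "continuous_on UNIV q"
    and bdd: "bounded (range X)"
    and min: "\<And>n y. f (X n) + ereal (q (X n)) \<le> f y + ereal (q y + e y n)"
    and e: "\<And>y. (e y) \<longlonglongrightarrow> 0"
  shows "\<exists>x. \<forall>y. f x + ereal (q x) \<le> f y + ereal (q y)"
proof -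
  obtain x \<sigma> where \<sigma>: "strict_mono (\<sigma> :: nat \<Rightarrow> nat)" and x: "(X \<circ> \<sigma>) \<longlonglongrightarrow> x"
    using bounded_subseq_limit[OF bdd] .
  have "f x + ereal (q x) \<le> f y + ereal (q y)" for y
  proof (cases "f y")
    case (real a)
    have qx: "(\<lambda>n. q (X (\<sigma> n))) \<longlonglongrightarrow> q x"
      using continuous_on_tendsto_compose[OF q x] by (simp add: o_def)
    have "(\<lambda>n. e y (\<sigma> n)) \<longlonglongrightarrow> 0"
      using LIMSEQ_subseq_LIMSEQ[OF e \<sigma>] by (simp add: o_def)
    then have lim: "(\<lambda>n. a + q y + e y (\<sigma> n) - q (X (\<sigma> n))) \<longlonglongrightarrow> a + q y + 0 - q x"
      using qx by (intro tendsto_intros)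
    have "f ((X \<circ> \<sigma>) n) \<le> ereal (a + q y + e y (\<sigma> n) - q (X (\<sigma> n)))" for n
      using min[of "\<sigma> n" y] real by (cases "f (X (\<sigma> n))") auto
    from lsc_fun_limit[OF lsc x lim this] show ?thesis
      using real by (cases "f x") auto
  next
    case PInf
    then show ?thesis by simp
  next
    case MInf
    then show ?thesis using proper by (simp add: proper_fun_def)
  qed
  then show ?thesis by blast
qed

text \<open>Convexity spreads a lower bound on the unit ball around a point of the domain, which
  compactness provides, to a bound of linear growth on the whole space. That bound is what a quadratic
  term has to beat.\<close>

lemma convex_lsc_linear_lower_bound:
  fixes f :: "'a::euclidean_space \<Rightarrow> ereal"
  assumes proper: "proper_fun f" and lsc: "lsc_fun f" and conv: "convex_fun f"
  shows "\<exists>K. \<forall>x. ereal (- K * (1 + norm x)) \<le> f x"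
proof -
  have nm: "f x \<noteq> -\<infinity>" for x
    using proper by (simp add: proper_fun_def)
  obtain z a where z: "f z = ereal a"
    using proper by (metis ereal_cases proper_fun_def)
  have "\<exists>m::real. \<forall>x\<in>cball z 1. ereal m \<le> f x"
  proof (rule ccontr)
    assume "\<not> ?thesis"
    then have "\<forall>n::nat. \<exists>x\<in>cball z 1. f x < ereal (- real n)"
      by (meson linorder_not_less)
    then obtain X where X: "\<And>n. X n \<in> cball z 1" "\<And>n. f (X n) < ereal (- real n)"
      by metis
    have "bounded (range X)"
      using X(1) bounded_cball bounded_subset by (metis image_subsetI)
    then obtain x \<sigma> where \<sigma>: "strict_mono (\<sigma> :: nat \<Rightarrow> nat)" and x: "(X \<circ> \<sigma>) \<longlonglongrightarrow> x"
      using bounded_subseq_limit by blast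
    have "f x \<le> ereal (- real k)" for k
    proof -
      have "(\<lambda>n. X (\<sigma> (n + k))) \<longlonglongrightarrow> x"
        using x LIMSEQ_ignore_initial_segment[of "X \<circ> \<sigma>" x k] by (simp add: o_def)
      moreover have "f (X (\<sigma> (n + k))) \<le> ereal (- real k)" for n
      proof -
        have "k \<le> \<sigma> (n + k)"
          using seq_suble[OF \<sigma>, of "n + k"] by simp
        then have "ereal (- real (\<sigma> (n + k))) \<le> ereal (- real k)" by simp
        then show ?thesis
          using X(2)[of "\<sigma> (n + k)"] by (meson order.trans less_imp_le)
      qed
      ultimately show ?thesis
        using lsc_fun_limit[OF lsc _ tendsto_const] by blast
    qed
    moreover obtain c where "f x = ereal c"
      using calculation[of 0] nm[of x] by (cases "f x") auto
    moreover obtain k :: nat where "- c < real k"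
      using reals_Archimedean2 by blast
    ultimately show False
      by (metis ereal_less_eq(3) linorder_not_less minus_less_iff)
  qed
  then obtain m where m: "\<And>x. x \<in> cball z 1 \<Longrightarrow> ereal m \<le> f x"
    by blast
  have ma: "m \<le> a"
    using m[of z] z by simp
  \<comment> \<open>\<open>\<bar>m\<bar>\<close> covers the unit ball; far away the bound drops with slope at most \<open>a - m\<close>, and
    \<open>norm (x - z) \<le> (1 + norm z) * (1 + norm x)\<close> moves the center from \<open>z\<close> to \<open>0\<close>\<close>
  define K where "K = \<bar>m\<bar> + (a - m) * (1 + norm z)"
  have "ereal (- K * (1 + norm x)) \<le> f x" for x
  proof (cases "x \<in> cball z 1")
    case True
    have "\<bar>m\<bar> \<le> K"
      using ma by (simp add: K_def)
    moreover have "K * 1 \<le> K * (1 + norm x)"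
      using calculation by (intro mult_left_mono) auto
    ultimately have "- K * (1 + norm x) \<le> m" by simp
    then show ?thesis
      using m[OF True] by (meson ereal_less_eq(3) order.trans)
  next
    case False
    \<comment> \<open>pull \<open>x\<close> towards \<open>z\<close> until it meets the unit sphere around \<open>z\<close>\<close>
    define r where "r = norm (x - z)"
    have r: "1 < r"
      using False by (simp add: r_def dist_norm norm_minus_commute)
    have "(1 - 1 / r) *\<^sub>R z + (1 / r) *\<^sub>R x = z + (1 / r) *\<^sub>R (x - z)"
      by (simp add: algebra_simps)
    moreover have "z + (1 / r) *\<^sub>R (x - z) \<in> cball z 1"
      using r by (simp add: dist_norm r_def)
    ultimately have "ereal m \<le> f ((1 - 1 / r) *\<^sub>R z + (1 / r) *\<^sub>R x)"
      using m by simp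
    also have "\<dots> \<le> ereal (1 - 1 / r) * f z + ereal (1 / r) * f x"
      using conv r by (simp add: convex_fun_def)
    finally have *: "ereal m \<le> ereal (1 - 1 / r) * f z + ereal (1 / r) * f x" .
    show ?thesis
    proof (cases "f x")
      case (real c)
      have "m \<le> (1 - 1 / r) * a + (1 / r) * c"
        using * z real by simp
      then have "r * m \<le> r * ((1 - 1 / r) * a + (1 / r) * c)"
        using r by (intro mult_left_mono) auto
      also have "\<dots> = (r - 1) * a + c"
        using r by (simp add: field_simps)
      finally have c: "m - (r - 1) * (a - m) \<le> c"
        by (simp add: algebra_simps)
      have "(r - 1) * (a - m) \<le> ((1 + norm z) * (1 + norm x)) * (a - m)"
      proof (rule mult_right_mono)
        have "r \<le> norm x + norm z"
          unfolding r_def by (rule norm_triangle_ineq4)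
        moreover have "0 \<le> norm x * norm z"
          by simp
        ultimately show "r - 1 \<le> (1 + norm z) * (1 + norm x)"
          by (simp add: algebra_simps del: norm_ge_zero mult_nonneg_nonneg)
      qed (use ma in simp)
      moreover have "\<bar>m\<bar> * 1 \<le> \<bar>m\<bar> * (1 + norm x)"
        by (intro mult_left_mono) auto
      moreover have "K * (1 + norm x)
          = \<bar>m\<bar> * (1 + norm x) + ((1 + norm z) * (1 + norm x)) * (a - m)"
        by (simp add: K_def algebra_simps)
      ultimately have "- K * (1 + norm x) \<le> c"
        using c by simp
      then show ?thesis using real by simp
    qed (use nm in auto)
  qed
  then show ?thesis by blast
qed

text \<open>The sum grows at least like \<open>norm x\<close>, so it is bounded below and its minimizing sequences
  are bounded.\<close>

lemma minimizer_exists_quadratic_growth: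
  fixes f :: "'a::euclidean_space \<Rightarrow> ereal" and q :: "'a \<Rightarrow> real"
  assumes proper: "proper_fun f" and lsc: "lsc_fun f" and conv: "convex_fun f"
    and q: "continuous_on UNIV q"
    and \<delta>: "0 < \<delta>" and growth: "\<And>x. \<delta> * (norm x)\<^sup>2 - \<beta> * norm x - \<gamma> \<le> q x"
  shows "\<exists>x. \<forall>y. f x + ereal (q x) \<le> f y + ereal (q y)"
proof -
  have nm: "f x \<noteq> -\<infinity>" for x
    using proper by (simp add: proper_fun_def)
  obtain z a where z: "f z = ereal a"
    using proper by (metis ereal_cases proper_fun_def)
  obtain K where K: "\<And>x. ereal (- K * (1 + norm x)) \<le> f x"
    using convex_lsc_linear_lower_bound[OF proper lsc conv] by blast
  define C where "C = K + \<gamma> + (K + \<beta> + 1)\<^sup>2 / (4 * \<delta>)"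
  have lower: "ereal (norm x - C) \<le> f x + ereal (q x)" for x
  proof -
    \<comment> \<open>completing the square in \<open>norm x\<close>\<close>
    have "0 \<le> (2 * \<delta> * norm x - (K + \<beta> + 1))\<^sup>2 / (4 * \<delta>)"
      using \<delta> by simp
    also have "\<dots> = \<delta> * (norm x)\<^sup>2 - (K + \<beta> + 1) * norm x + (K + \<beta> + 1)\<^sup>2 / (4 * \<delta>)"
      using \<delta> by (simp add: field_simps power2_eq_square)
    finally have "norm x - C \<le> - K * (1 + norm x) + q x"
      using growth[of x] by (simp add: C_def algebra_simps)
    then have "ereal (norm x - C) \<le> ereal (- K * (1 + norm x)) + ereal (q x)"
      by simp
    also have "\<dots> \<le> f x + ereal (q x)"
      by (intro add_right_mono K)
    finally show ?thesis .
  qed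
  define \<mu> where "\<mu> = (INF x. f x + ereal (q x))"
  have "ereal (- C) \<le> \<mu>"
    unfolding \<mu>_def
  proof (rule INF_greatest)
    fix x :: 'a
    have "ereal (- C) \<le> ereal (norm x - C)" by simp
    then show "ereal (- C) \<le> f x + ereal (q x)"
      using lower order.trans by blast
  qed
  moreover have "\<mu> \<le> ereal (a + q z)"
    unfolding \<mu>_def using INF_lower[of z UNIV "\<lambda>x. f x + ereal (q x)"] z by simp
  ultimately obtain u where u: "\<mu> = ereal u"
    by (cases \<mu>) auto
  have "\<exists>x. f x + ereal (q x) < ereal (u + inverse (real (Suc n)))" for n
  proof -
    have "\<mu> < ereal (u + inverse (real (Suc n)))"
      using u by simp
    then show ?thesis
      unfolding \<mu>_def by (simp add: INF_less_iff)
  qed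
  then obtain X where X: "\<And>n. f (X n) + ereal (q (X n)) < ereal (u + inverse (real (Suc n)))"
    by metis
  have "norm (X n) \<le> u + 1 + C" for n
  proof -
    have "ereal (norm (X n) - C) < ereal (u + inverse (real (Suc n)))"
      using lower X by (meson order.strict_trans1)
    moreover have "inverse (real (Suc n)) \<le> 1"
      by (simp add: field_simps)
    ultimately show ?thesis by simp
  qed
  then have bdd: "bounded (range X)"
    by (auto simp: bounded_iff)
  have "f (X n) + ereal (q (X n)) \<le> f y + ereal (q y + inverse (real (Suc n)))" for n y
  proof -
    have "ereal u \<le> f y + ereal (q y)"
      unfolding u[symmetric] \<mu>_def by (rule INF_lower) simp
    then have "ereal (u + inverse (real (Suc n))) \<le> f y + ereal (q y + inverse (real (Suc n)))"
      by (cases "f y") auto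
    then show ?thesis
      using X[of n] by (meson less_imp_le order.trans)
  qed
  then show ?thesis
    using minimizer_of_bounded_minimizing_seq[OF proper lsc q bdd _ LIMSEQ_inverse_real_of_nat]
    by blast
qed

section \<open>Subdifferentials\<close>

lemma monotone_subdifferential:
  fixes f :: "'a::real_inner \<Rightarrow> ereal"
  assumes "proper_fun f"
  shows "monotone_op (subdifferential f)"
  unfolding monotone_op_def
proof (intro allI ballI)
  fix x y u v
  assume u: "u \<in> subdifferential f x" and v: "v \<in> subdifferential f y"
  have "f x + ereal (u \<bullet> (y - x)) \<le> f y" "f y + ereal (v \<bullet> (x - y)) \<le> f x"
    using u v by (auto simp: subdifferential_def)
  moreover obtain z where "f z \<noteq> \<infinity>" "f x + ereal (u \<bullet> (z - x)) \<le> f z"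
    using u assms by (auto simp: subdifferential_def proper_fun_def)
  moreover have "f x \<noteq> -\<infinity>" "f y \<noteq> -\<infinity>"
    using assms by (auto simp: proper_fun_def)
  ultimately show "0 \<le> (x - y) \<bullet> (u - v)"
    by (cases "f x"; cases "f y") (auto simp: inner_commute algebra_simps)
qed

lemma subdifferential_finite:
  assumes "proper_fun f" and "v \<in> subdifferential f x"
  obtains a where "f x = ereal a"
proof -
  obtain z where "f z \<noteq> \<infinity>" "f x + ereal (v \<bullet> (z - x)) \<le> f z"
    using assms by (auto simp: subdifferential_def proper_fun_def)
  moreover have "f x \<noteq> -\<infinity>"
    using assms by (auto simp: proper_fun_def)
  ultimately show thesis
    using that by (cases "f x") auto
qed

text \<open>First order optimality. The bounds make \<open>g\<close> the gradient of \<open>q\<close> at \<open>x\<close>, with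
  linearization below \<open>q\<close>. Sufficiency is then immediate, and stationarity follows from minimality by comparing \<open>x\<close> with points
  \<open>x + t (y - x)\<close> and letting \<open>t\<close> tend to \<open>0\<close>.\<close>

lemma minimizer_sum_iff_subgradient:
  fixes f :: "'a::real_inner \<Rightarrow> ereal" and q :: "'a \<Rightarrow> real"
  assumes proper: "proper_fun f" and conv: "convex_fun f"
    and below: "\<And>y. q x + g \<bullet> (y - x) \<le> q y"
    and above: "\<And>y. q y \<le> q x + g \<bullet> (y - x) + c * (norm (y - x))\<^sup>2"
  shows "(\<forall>y. f x + ereal (q x) \<le> f y + ereal (q y)) \<longleftrightarrow> - g \<in> subdifferential f x"
proof
  assume "- g \<in> subdifferential f x"
  then have "f x + ereal (- g \<bullet> (y - x)) \<le> f y" for y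
    by (simp add: subdifferential_def)
  then show "\<forall>y. f x + ereal (q x) \<le> f y + ereal (q y)"
  proof (intro allI)
    fix y
    assume "\<And>y. f x + ereal (- g \<bullet> (y - x)) \<le> f y"
    from this[of y] below[of y] show "f x + ereal (q x) \<le> f y + ereal (q y)"
      by (cases "f x"; cases "f y") (auto simp: inner_minus_left)
  qed
next
  assume min: "\<forall>y. f x + ereal (q x) \<le> f y + ereal (q y)"
  have nm: "f x \<noteq> -\<infinity>" for x
    using proper by (simp add: proper_fun_def)
  obtain z where "f z \<noteq> \<infinity>"
    using proper by (auto simp: proper_fun_def)
  then obtain a where a: "f x = ereal a"
    using min[rule_format, of z] nm[of x] by (cases "f x"; cases "f z") auto
  have "f x + ereal (- g \<bullet> (y - x)) \<le> f y" for y
  proof (cases "f y")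
    case (real b)
    define N where "N = c * (norm (y - x))\<^sup>2"
    have *: "a - b - g \<bullet> (y - x) \<le> t * N" if t: "0 < t" "t < 1" for t :: real
    proof -
      define w where "w = (1 - t) *\<^sub>R x + t *\<^sub>R y"
      have w: "w - x = t *\<^sub>R (y - x)"
        by (simp add: w_def algebra_simps)
      have "f w \<le> ereal (1 - t) * f x + ereal t * f y"
        using conv t by (simp add: convex_fun_def w_def)
      then have "f w \<le> ereal ((1 - t) * a + t * b)"
        using a real by simp
      moreover have "f x + ereal (q x) \<le> f w + ereal (q w)"
        using min by blast
      ultimately have "a + q x \<le> (1 - t) * a + t * b + q w"
        using a nm[of w] by (cases "f w") auto
      also have "q w \<le> q x + t * (g \<bullet> (y - x)) + c * (t * norm (y - x))\<^sup>2"
        using above[of w] t by (simp add: w)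
      finally have "t * (a - b - g \<bullet> (y - x)) \<le> t * (t * N)"
        by (simp add: N_def algebra_simps power2_eq_square)
      then show ?thesis
        using t by simp
    qed
    have "((\<lambda>t. t * N) \<longlongrightarrow> 0 * N) (at_right 0)"
      by (intro tendsto_intros)
    moreover have "eventually (\<lambda>t. a - b - g \<bullet> (y - x) \<le> t * N) (at_right 0)"
      using * by (intro eventually_at_rightI[of 0 1]) auto
    ultimately have "a - b - g \<bullet> (y - x) \<le> 0 * N"
      by (intro tendsto_lowerbound[of _ _ "at_right (0::real)"]) auto
    then show ?thesis
      using a real by (simp add: inner_minus_left)
  qed (use nm in auto)
  then show "- g \<in> subdifferential f x"
    by (simp add: subdifferential_def)
qed

text \<open>One family of quadratics, hence one optimality condition, serves four purposes: \<open>\<epsilon> = 0\<close> and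
  \<open>v = 0\<close> give the least squares problem itself, \<open>\<epsilon> > 0\<close> its Tikhonov regularization,
  \<open>B = 0\<close> and \<open>\<epsilon> = 1\<close> the objective of the proximal point of \<open>v\<close> up to a constant, and \<open>B = 0\<close> and \<open>\<epsilon> = 0\<close>
  the test whether \<open>v\<close> is a subgradient somewhere.\<close>

definition reg_lsq ::
    "('a::real_inner \<Rightarrow> 'b::real_inner) \<Rightarrow> 'b \<Rightarrow> real \<Rightarrow> 'a \<Rightarrow> 'a \<Rightarrow> real" where
  "reg_lsq B b \<epsilon> v x = 1 / 2 * (norm (B x - b))\<^sup>2 + \<epsilon> / 2 * (norm x)\<^sup>2 - v \<bullet> x"

lemma reg_lsq_expand:
  fixes B :: "'a::euclidean_space \<Rightarrow> 'b::euclidean_space"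
  assumes "linear B"
  shows "reg_lsq B b \<epsilon> v y = reg_lsq B b \<epsilon> v x
    + (adjoint B (B x - b) + \<epsilon> *\<^sub>R x - v) \<bullet> (y - x)
    + (1 / 2 * (norm (B (y - x)))\<^sup>2 + \<epsilon> / 2 * (norm (y - x))\<^sup>2)"
proof -
  have 1: "B y - b = (B x - b) + B (y - x)"
    using assms by (simp add: linear_diff)
  have 2: "(norm (u + h))\<^sup>2 = (norm u)\<^sup>2 + 2 * (u \<bullet> h) + (norm h)\<^sup>2" for u h :: "'c::real_inner"
    by (simp add: power2_norm_eq_inner algebra_simps inner_commute)
  have 3: "(norm y)\<^sup>2 = (norm x)\<^sup>2 + 2 * (x \<bullet> (y - x)) + (norm (y - x))\<^sup>2"
    using 2[of x "y - x"] by simp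
  have 4: "adjoint B (B x - b) \<bullet> (y - x) = (B x - b) \<bullet> B (y - x)"
    using adjoint_clauses(2)[OF assms] .
  show ?thesis
    unfolding reg_lsq_def 1 2 3
    by (simp only: inner_add_left inner_diff_left inner_scaleR_left 4)
       (simp add: algebra_simps inner_diff_right)
qed

lemma minimizer_reg_lsq_iff:
  fixes f :: "'a::euclidean_space \<Rightarrow> ereal" and B :: "'a \<Rightarrow> 'b::euclidean_space"
  assumes "proper_fun f" and "convex_fun f" and B: "linear B" and \<epsilon>: "0 \<le> \<epsilon>"
  shows "(\<forall>y. f x + ereal (reg_lsq B b \<epsilon> v x) \<le> f y + ereal (reg_lsq B b \<epsilon> v y)) \<longleftrightarrow>
    v + adjoint B (b - B x) - \<epsilon> *\<^sub>R x \<in> subdifferential f x"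
proof -
  obtain K where K: "\<And>h. norm (B h) \<le> norm h * K"
    using linear_conv_bounded_linear[of B] B bounded_linear.bounded by blast
  have *: "(norm (B h))\<^sup>2 \<le> K\<^sup>2 * (norm h)\<^sup>2" for h
    using power_mono[OF K[of h] norm_ge_zero, of 2] by (simp add: power_mult_distrib mult.commute)
  have "(\<forall>y. f x + ereal (reg_lsq B b \<epsilon> v x) \<le> f y + ereal (reg_lsq B b \<epsilon> v y)) \<longleftrightarrow>
    - (adjoint B (B x - b) + \<epsilon> *\<^sub>R x - v) \<in> subdifferential f x"
  proof (rule minimizer_sum_iff_subgradient[OF assms(1,2), where c = "K\<^sup>2 / 2 + \<epsilon> / 2"])
    fix y
    show "reg_lsq B b \<epsilon> v x + (adjoint B (B x - b) + \<epsilon> *\<^sub>R x - v) \<bullet> (y - x) \<le> reg_lsq B b \<epsilon> v y"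
      using \<epsilon> by (subst reg_lsq_expand[OF B, of b \<epsilon> v y x]) simp
    show "reg_lsq B b \<epsilon> v y \<le> reg_lsq B b \<epsilon> v x
        + (adjoint B (B x - b) + \<epsilon> *\<^sub>R x - v) \<bullet> (y - x) + (K\<^sup>2 / 2 + \<epsilon> / 2) * (norm (y - x))\<^sup>2"
      using *[of "y - x"]
      by (subst reg_lsq_expand[OF B, of b \<epsilon> v y x]) (simp add: algebra_simps)
  qed
  also have "- (adjoint B (B x - b) + \<epsilon> *\<^sub>R x - v) = v + adjoint B (b - B x) - \<epsilon> *\<^sub>R x"
    by (simp only: linear_diff[OF adjoint_linear[OF B]]) (simp add: algebra_simps)
  finally show ?thesis .
qed

lemma reg_lsq_minimizer_exists:
  fixes f :: "'a::euclidean_space \<Rightarrow> ereal" and B :: "'a \<Rightarrow> 'b::euclidean_space"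
  assumes "proper_fun f" and "lsc_fun f" and "convex_fun f" and B: "linear B" and \<epsilon>: "0 < \<epsilon>"
  shows "\<exists>x. \<forall>y. f x + ereal (reg_lsq B b \<epsilon> v x) \<le> f y + ereal (reg_lsq B b \<epsilon> v y)"
proof (rule minimizer_exists_quadratic_growth[OF assms(1-3)])
  show "continuous_on UNIV (reg_lsq B b \<epsilon> v)"
    unfolding reg_lsq_def using linear_continuous_on[of B UNIV] B
    by (intro continuous_intros) (simp add: linear_conv_bounded_linear)
  show "0 < \<epsilon> / 2"
    using \<epsilon> by simp
  fix x :: 'a
  have "v \<bullet> x \<le> norm v * norm x"
    by (rule norm_cauchy_schwarz)
  moreover have "0 \<le> (norm (B x - b))\<^sup>2"
    by simp
  ultimately show "\<epsilon> / 2 * (norm x)\<^sup>2 - norm v * norm x - 0 \<le> reg_lsq B b \<epsilon> v x"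
    unfolding reg_lsq_def by linarith
qed

lemma adjoint_zero: "adjoint (\<lambda>x::'a::euclidean_space. 0::'b::euclidean_space) = (\<lambda>y. 0)"
  by (rule adjoint_unique) simp

text \<open>The point \<open>x\<close> is the proximal point of \<open>b\<close>, the minimizer of
  \<open>f x + 1 / 2 * (norm x)\<^sup>2 - b \<bullet> x\<close>.\<close>

lemma subdifferential_resolvent_total:
  fixes f :: "'a::euclidean_space \<Rightarrow> ereal"
  assumes "proper_fun f" and "lsc_fun f" and "convex_fun f"
  shows "\<exists>x. b - x \<in> subdifferential f x"
proof -
  have lin: "linear (\<lambda>x::'a. 0::'a)"
    by (rule module_hom_zero)
  show ?thesis
    using reg_lsq_minimizer_exists[OF assms lin zero_less_one, of 0 b]
      minimizer_reg_lsq_iff[OF assms(1,3) lin zero_le_one, of _ 0 b]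
    by (simp add: adjoint_zero)
qed

section \<open>Maximal monotonicity\<close>

text \<open>The elementary half of Minty's theorem: if \<open>u\<close> is an additional value at \<open>x\<close>, solve
  \<open>x + u \<in> y + M y\<close> and compare the two points of the graph.\<close>

lemma maximally_monotone_if_resolvent_total:
  fixes M :: "'a::real_inner \<Rightarrow> 'a set"
  assumes mono: "monotone_op M" and total: "\<And>b. \<exists>y. b - y \<in> M y"
  shows "maximally_monotone M"
  unfolding maximally_monotone_def
proof (intro conjI allI impI mono)
  fix C :: "'a \<Rightarrow> 'a set"
  assume C: "monotone_op C \<and> (\<forall>x. M x \<subseteq> C x)"
  have "C x \<subseteq> M x" for x
  proof
    fix u
    assume u: "u \<in> C x"
    obtain y where y: "x + u - y \<in> M y"
      using total by blast
    then have "0 \<le> (x - y) \<bullet> (u - (x + u - y))"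
      using C u unfolding monotone_op_def by blast
    then have "(x - y) \<bullet> (x - y) \<le> 0"
      by (simp add: algebra_simps)
    then have "x = y"
      by (metis inner_eq_zero_iff inner_ge_zero order_antisym right_minus_eq)
    then show "u \<in> M x"
      using y by simp
  qed
  then show "C = M"
    using C by (intro ext) blast
qed

text \<open>The empty operator is a proper restriction of the constant operator \<open>{0}\<close>.\<close>

lemma maximally_monotone_nonempty:
  fixes M :: "'a::real_inner \<Rightarrow> 'a set"
  assumes "maximally_monotone M"
  shows "\<exists>x. M x \<noteq> {}"
proof (rule ccontr)
  assume empty: "\<not> ?thesis"
  moreover have "monotone_op (\<lambda>x::'a. {0::'a})"
    by (simp add: monotone_op_def)
  ultimately have "(\<lambda>x::'a. {0::'a}) = M"
    using assms unfolding maximally_monotone_def by blast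
  then have "M 0 = {0}"
    by (metis (mono_tags))
  then show False
    using empty by simp
qed

section \<open>The conjugate function\<close>

lemma fenchel_young: "ereal (v \<bullet> x) - f x \<le> conjugate f v"
  unfolding conjugate_def by (rule SUP_upper) simp

lemma conjugate_not_MInfty:
  assumes "proper_fun f"
  shows "conjugate f v \<noteq> -\<infinity>"
proof -
  obtain x a where "f x = ereal a"
    using assms by (metis ereal_cases proper_fun_def)
  then show ?thesis
    using fenchel_young[of v x f] by auto
qed

lemma conjugate_eq_if_subgradient:
  assumes "proper_fun f" and v: "v \<in> subdifferential f x"
  shows "conjugate f v = ereal (v \<bullet> x) - f x"
proof (rule antisym)
  obtain a where a: "f x = ereal a"
    using subdifferential_finite[OF assms] .
  show "conjugate f v \<le> ereal (v \<bullet> x) - f x"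
    unfolding conjugate_def
  proof (rule SUP_least)
    fix y
    have "f x + ereal (v \<bullet> (y - x)) \<le> f y"
      using v by (simp add: subdifferential_def)
    then show "ereal (v \<bullet> y) - f y \<le> ereal (v \<bullet> x) - f x"
      using a by (cases "f y") (auto simp: inner_diff_right)
  qed
qed (rule fenchel_young)

lemma subgradient_conjugate:
  assumes "proper_fun f" and v: "v \<in> subdifferential f x"
  shows "x \<in> subdifferential (conjugate f) v"
proof -
  obtain a where a: "f x = ereal a"
    using subdifferential_finite[OF assms] .
  have "conjugate f v + ereal (x \<bullet> (w - v)) \<le> conjugate f w" for w
    using fenchel_young[of w x f] conjugate_eq_if_subgradient[OF assms] a
    by (cases "conjugate f w") (auto simp: inner_diff_right inner_commute)
  then show ?thesis
    by (simp add: subdifferential_def)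
qed

text \<open>The conjugate is finite at every subgradient, and a proximal point supplies one.\<close>

lemma proper_conjugate:
  fixes f :: "'a::euclidean_space \<Rightarrow> ereal"
  assumes "proper_fun f" and "lsc_fun f" and "convex_fun f"
  shows "proper_fun (conjugate f)"
proof -
  obtain x where x: "0 - x \<in> subdifferential f x"
    using subdifferential_resolvent_total[OF assms] by blast
  then obtain a where "f x = ereal a"
    using subdifferential_finite[OF assms(1)] by blast
  then have "conjugate f (0 - x) \<noteq> \<infinity>"
    using conjugate_eq_if_subgradient[OF assms(1) x] by simp
  then show ?thesis
    using conjugate_not_MInfty[OF assms(1)] by (auto simp: proper_fun_def)
qed

lemma convex_conjugate:
  assumes proper: "proper_fun f"
  shows "convex_fun (conjugate f)"
  unfolding convex_fun_def
proof (intro allI impI)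
  fix v w and t :: real
  assume t: "0 < t \<and> t < 1"
  show "conjugate f ((1 - t) *\<^sub>R v + t *\<^sub>R w)
      \<le> ereal (1 - t) * conjugate f v + ereal t * conjugate f w"
    unfolding conjugate_def[of f "(1 - t) *\<^sub>R v + t *\<^sub>R w"]
  proof (rule SUP_least)
    fix x
    show "ereal (((1 - t) *\<^sub>R v + t *\<^sub>R w) \<bullet> x) - f x
        \<le> ereal (1 - t) * conjugate f v + ereal t * conjugate f w"
    proof (cases "f x")
      case (real a)
      have v: "ereal (v \<bullet> x - a) \<le> conjugate f v" and w: "ereal (w \<bullet> x - a) \<le> conjugate f w"
        using fenchel_young[of _ x f] real by auto
      have "ereal (((1 - t) *\<^sub>R v + t *\<^sub>R w) \<bullet> x) - f x
          = ereal (1 - t) * ereal (v \<bullet> x - a) + ereal t * ereal (w \<bullet> x - a)"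
        using real by (simp add: algebra_simps)
      also have "\<dots> \<le> ereal (1 - t) * conjugate f v + ereal t * conjugate f w"
        using t v w by (intro add_mono ereal_mult_left_mono) auto
      finally show ?thesis .
    qed (use proper in \<open>auto simp: proper_fun_def\<close>)
  qed
qed

lemma convex_dom_conjugate:
  assumes proper: "proper_fun f"
  shows "convex {s. conjugate f s < \<infinity>}"
  unfolding convex_alt
proof (intro ballI allI impI)
  fix v w and t :: real
  assume v: "v \<in> {s. conjugate f s < \<infinity>}" and w: "w \<in> {s. conjugate f s < \<infinity>}"
    and t: "0 \<le> t \<and> t \<le> 1"
  obtain a b where ab: "conjugate f v = ereal a" "conjugate f w = ereal b"
    using v w conjugate_not_MInfty[OF proper] by (metis ereal_cases less_irrefl mem_Collect_eq)
  show "(1 - t) *\<^sub>R v + t *\<^sub>R w \<in> {s. conjugate f s < \<infinity>}"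
  proof (cases "t = 0 \<or> t = 1")
    case False
    then have "conjugate f ((1 - t) *\<^sub>R v + t *\<^sub>R w)
        \<le> ereal (1 - t) * conjugate f v + ereal t * conjugate f w"
      using t convex_conjugate[OF proper] by (simp add: convex_fun_def)
    also have "\<dots> < \<infinity>"
      by (simp add: ab)
    finally show ?thesis by simp
  qed (use v w in auto)
qed

lemma op_ran_subdifferential_subset:
  assumes "proper_fun f"
  shows "op_ran (subdifferential f) \<subseteq> {s. conjugate f s < \<infinity>}"
proof
  fix s
  assume "s \<in> op_ran (subdifferential f)"
  then obtain x where s: "s \<in> subdifferential f x"
    by (auto simp: op_ran_def)
  then obtain a where "f x = ereal a"
    using subdifferential_finite[OF assms] by blast
  then show "s \<in> {s. conjugate f s < \<infinity>}"
    using conjugate_eq_if_subgradient[OF assms s] by simp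
qed

text \<open>A supremum of continuous functions is lower semicontinuous; the composition with a linear
  map is included because it is \<open>f\<^sup>* \<circ> A\<^sup>T\<close> that is needed.\<close>

lemma lsc_conjugate_linear:
  fixes f :: "'a::euclidean_space \<Rightarrow> ereal" and L :: "'b::euclidean_space \<Rightarrow> 'a"
  assumes proper: "proper_fun f" and L: "linear L"
  shows "lsc_fun (\<lambda>y. conjugate f (L y))"
  unfolding lsc_fun_iff_open
proof
  fix c
  have cont: "continuous_on UNIV (\<lambda>y. L y \<bullet> x)" for x
    using linear_continuous_on[of L UNIV] L
    by (intro continuous_intros) (simp add: linear_conv_bounded_linear)
  have "open {y. c < ereal (L y \<bullet> x) - f x}" for x
  proof (cases "f x")
    case (real a)
    show ?thesis
    proof (cases c)
      case (real d)
      have "{y. c < ereal (L y \<bullet> x) - f x} = {y. d + a < L y \<bullet> x}"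
        using real \<open>f x = ereal a\<close> by auto
      then show ?thesis
        using cont by (simp add: open_Collect_less continuous_on_const)
    qed (use real in auto)
  qed (use proper in \<open>auto simp: proper_fun_def\<close>)
  then have "open (\<Union>x. {y. c < ereal (L y \<bullet> x) - f x})"
    by blast
  also have "(\<Union>x. {y. c < ereal (L y \<bullet> x) - f x}) = {y. c < conjugate f (L y)}"
    unfolding conjugate_def by (auto simp: less_SUP_iff)
  finally show "open {y. c < conjugate f (L y)}" .
qed

text \<open>The graph of \<open>(\<partial>f\<^sup>*)\<inverse>\<close> is monotone and contains that of \<open>\<partial>f\<close>, which is maximal
  because its resolvent is total. Hence the two agree.\<close>

lemma op_inv_subdifferential:
  fixes f :: "'a::euclidean_space \<Rightarrow> ereal"
  assumes "proper_fun f" and "lsc_fun f" and "convex_fun f"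
  shows "op_inv (subdifferential f) = subdifferential (conjugate f)"
proof -
  define C where "C = op_inv (subdifferential (conjugate f))"
  have "maximally_monotone (subdifferential f)"
    using maximally_monotone_if_resolvent_total monotone_subdifferential
      subdifferential_resolvent_total assms by blast
  moreover have "monotone_op C"
    using monotone_subdifferential[OF proper_conjugate[OF assms]]
    unfolding monotone_op_def C_def op_inv_def by (metis inner_commute mem_Collect_eq)
  moreover have "\<forall>x. subdifferential f x \<subseteq> C x"
    using subgradient_conjugate[OF assms(1)] by (auto simp: C_def op_inv_def)
  ultimately have "C = subdifferential f"
    unfolding maximally_monotone_def by blast
  then show ?thesis
    by (auto simp: C_def op_inv_def fun_eq_iff)
qed

corollary subdifferential_conjugate_iff:
  fixes f :: "'a::euclidean_space \<Rightarrow> ereal"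
  assumes "proper_fun f" and "lsc_fun f" and "convex_fun f"
  shows "x \<in> subdifferential (conjugate f) v \<longleftrightarrow> v \<in> subdifferential f x"
  by (simp add: op_inv_subdifferential[OF assms, symmetric] op_inv_def)

section \<open>Existence under a relative interior condition\<close>

text \<open>Boundedness in a subspace can be tested on the coordinate functionals, which
  there are inner products with the projections of the basis vectors.\<close>

lemma bounded_if_inner_bounded_above:
  fixes X :: "'a::euclidean_space set"
  assumes W: "subspace W" and XW: "X \<subseteq> W"
    and bdd: "\<And>w. w \<in> W \<Longrightarrow> \<exists>C. \<forall>x\<in>X. w \<bullet> x \<le> C"
  shows "bounded X"
proof -
  have "\<exists>C. \<forall>x\<in>X. \<bar>x \<bullet> i\<bar> \<le> C" for i
  proof -
    obtain w z where w: "w \<in> span W" and z: "\<And>u. u \<in> span W \<Longrightarrow> orthogonal z u"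
      and i: "i = w + z"
      using orthogonal_subspace_decomp_exists[of W i] by metis
    have span: "span W = W"
      using W by (rule span_eq_iff[THEN iffD2])
    have "- w \<in> W"
      using w W span subspace_neg by blast
    then obtain C D where C: "\<And>x. x \<in> X \<Longrightarrow> w \<bullet> x \<le> C" and D: "\<And>x. x \<in> X \<Longrightarrow> (- w) \<bullet> x \<le> D"
      using bdd w span by metis
    have "\<bar>x \<bullet> i\<bar> \<le> max C D" if "x \<in> X" for x
    proof -
      have "x \<bullet> i = w \<bullet> x"
        using z[of x] that XW span by (auto simp: i orthogonal_def inner_add_right inner_commute)
      then show ?thesis
        using C[OF that] D[OF that] by auto
    qed
    then show ?thesis by blast
  qed
  then obtain C where C: "\<And>x i. x \<in> X \<Longrightarrow> \<bar>x \<bullet> i\<bar> \<le> C i"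
    by metis
  have "norm x \<le> (\<Sum>i\<in>Basis. C i)" if "x \<in> X" for x
    using norm_le_l1[of x] sum_mono[of Basis "\<lambda>i. \<bar>x \<bullet> i\<bar>" C] C[OF that] by fastforce
  then show ?thesis
    by (auto simp: bounded_iff)
qed

text \<open>Minimizers \<open>X n\<close> of the regularized problems exist, and the point is to bound them. Let \<open>T\<close>
  be the set in the hypothesis and \<open>W\<close> the direction space of its affine hull. Stationarity of
  \<open>X n\<close> writes \<open>v - \<epsilon> n X n\<close> as an element of \<open>T\<close>, so \<open>X n\<close> lies in \<open>W\<close>. Conversely each small
  \<open>w\<close> in \<open>W\<close> gives an element \<open>v + w\<close> of \<open>T\<close>, that is, a slope \<open>s\<close> of an affine minorant of
  \<open>f\<close> with \<open>v + w = s + B\<^sup>T u\<close>; together with the least squares term, which controls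
  \<open>u \<bullet> B x\<close>, the minorant bounds the objective below by \<open>w \<bullet> x\<close> up to a constant. Since the
  objective is bounded above along \<open>X\<close>, so is \<open>w \<bullet> X n\<close>. Being bounded, \<open>X\<close> clusters at a
  minimizer of the problem without regularization.\<close>

lemma minimizer_exists_if_rel_interior:
  fixes f :: "'a::euclidean_space \<Rightarrow> ereal" and B :: "'a \<Rightarrow> 'b::euclidean_space"
  assumes proper: "proper_fun f" and lsc: "lsc_fun f" and conv: "convex_fun f"
    and B: "linear B"
    and v: "v \<in> rel_interior ({s. conjugate f s < \<infinity>} + range (adjoint B))"
  shows "\<exists>x. \<forall>y. f x + ereal (reg_lsq B b 0 v x) \<le> f y + ereal (reg_lsq B b 0 v y)"
proof -
  define T where "T = {s. conjugate f s < \<infinity>} + range (adjoint B)"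
  define W where "W = span ((+) (- v) ` T)"
  obtain e where vT: "v \<in> T" and e: "0 < e" and ball: "ball v e \<inter> affine hull T \<subseteq> T"
    using v mem_rel_interior_ball[of v T] by (auto simp: T_def)
  have hull: "affine hull T = (+) v ` W"
    unfolding W_def by (rule affine_hull_span_gen) (rule hull_inc[OF vT])
  have W: "subspace W"
    unfolding W_def by (rule subspace_span)
  define \<epsilon> where "\<epsilon> n = inverse (real (Suc n))" for n
  have \<epsilon>: "0 < \<epsilon> n" "\<epsilon> n \<le> 1" for n
    by (auto simp: \<epsilon>_def field_simps)
  obtain X where X: "\<And>n y. f (X n) + ereal (reg_lsq B b (\<epsilon> n) v (X n))
      \<le> f y + ereal (reg_lsq B b (\<epsilon> n) v y)"
    using reg_lsq_minimizer_exists[OF proper lsc conv B \<epsilon>(1), of b _ v] by metis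
  have XW: "X n \<in> W" for n
  proof -
    define s where "s = v + adjoint B (b - B (X n)) - \<epsilon> n *\<^sub>R X n"
    have "s \<in> subdifferential f (X n)"
      unfolding s_def
      by (rule minimizer_reg_lsq_iff[OF proper conv B less_imp_le[OF \<epsilon>(1)], THEN iffD1])
         (intro allI X)
    then have "conjugate f s < \<infinity>"
      using op_ran_subdifferential_subset[OF proper] by (auto simp: op_ran_def)
    then have "s + adjoint B (B (X n) - b) \<in> T"
      unfolding T_def by (intro set_plus_intro) auto
    moreover have "s + adjoint B (B (X n) - b) = v - \<epsilon> n *\<^sub>R X n"
      unfolding s_def by (simp only: linear_diff[OF adjoint_linear[OF B]]) simp
    ultimately have "- v + (v - \<epsilon> n *\<^sub>R X n) \<in> W"
      unfolding W_def by (intro span_base imageI) simp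
    then have "(- inverse (\<epsilon> n)) *\<^sub>R (- (\<epsilon> n *\<^sub>R X n)) \<in> W"
      using W by (intro subspace_scale) auto
    then show ?thesis
      using \<epsilon>(1)[of n] by simp
  qed
  have min: "f (X n) + ereal (reg_lsq B b 0 v (X n))
      \<le> f y + ereal (reg_lsq B b 0 v y + \<epsilon> n / 2 * (norm y)\<^sup>2)" for n y
  proof -
    have "reg_lsq B b 0 v (X n) \<le> reg_lsq B b (\<epsilon> n) v (X n)"
      using \<epsilon>(1)[of n] by (simp add: reg_lsq_def)
    then have "f (X n) + ereal (reg_lsq B b 0 v (X n)) \<le> f (X n) + ereal (reg_lsq B b (\<epsilon> n) v (X n))"
      by (intro add_left_mono) simp
    also have "\<dots> \<le> f y + ereal (reg_lsq B b (\<epsilon> n) v y)"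
      by (rule X)
    also have "reg_lsq B b (\<epsilon> n) v y = reg_lsq B b 0 v y + \<epsilon> n / 2 * (norm y)\<^sup>2"
      by (simp add: reg_lsq_def)
    finally show ?thesis .
  qed
  obtain z a where z: "f z = ereal a"
    using proper by (metis ereal_cases proper_fun_def)
  define C where "C = a + reg_lsq B b 0 v z + 1 / 2 * (norm z)\<^sup>2"
  have level: "f (X n) + ereal (reg_lsq B b 0 v (X n)) \<le> ereal C" for n
  proof -
    have "\<epsilon> n / 2 * (norm z)\<^sup>2 \<le> 1 / 2 * (norm z)\<^sup>2"
      using \<epsilon>(2)[of n] by (intro mult_right_mono) auto
    then have "f z + ereal (reg_lsq B b 0 v z + \<epsilon> n / 2 * (norm z)\<^sup>2) \<le> ereal C"
      by (simp add: z C_def)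
    then show ?thesis
      using min order.trans by blast
  qed
  have "bounded (range X)"
  proof (rule bounded_if_inner_bounded_above[OF W])
    show "range X \<subseteq> W"
      using XW by blast
    fix w
    assume w: "w \<in> W"
    \<comment> \<open>the factor \<open>c\<close> brings \<open>v + c w\<close> into the ball around \<open>v\<close>\<close>
    define c where "c = e / (2 * (norm w + 1))"
    have c: "0 < c"
      using e by (simp add: c_def add_nonneg_pos)
    have "norm (c *\<^sub>R w) < e"
    proof -
      have "norm (c *\<^sub>R w) = e * (norm w / (2 * (norm w + 1)))"
        using c e by (simp add: c_def abs_mult)
      also have "\<dots> < e * 1"
        using e by (intro mult_strict_left_mono) (auto simp: divide_less_eq_1 add_nonneg_pos)
      finally show ?thesis by simp
    qed
    then have "v + c *\<^sub>R w \<in> T"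
      using ball w W hull subspace_scale[OF W w] by (intro subsetD[OF ball]) (auto simp: dist_norm)
    then obtain s u where s: "conjugate f s < \<infinity>" and su: "v + c *\<^sub>R w = s + adjoint B u"
      unfolding T_def by (auto elim: set_plus_elim)
    obtain k where k: "conjugate f s = ereal k"
      using s conjugate_not_MInfty[OF proper, of s] by (cases "conjugate f s") auto
    have "w \<bullet> X n \<le> (C + k + 1 / 2 * (norm u)\<^sup>2 + u \<bullet> b) / c" for n
    proof -
      obtain d where d: "f (X n) = ereal d"
        using level[of n] proper by (cases "f (X n)") (auto simp: proper_fun_def)
      have "d + reg_lsq B b 0 v (X n) \<le> C"
        using level[of n] d by simp
      moreover have "s \<bullet> X n - d \<le> k"
        using fenchel_young[of s "X n" f] k d by simp
      moreover have "s \<bullet> X n = v \<bullet> X n + c * (w \<bullet> X n) - u \<bullet> B (X n)"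
      proof -
        have "s = v + c *\<^sub>R w - adjoint B u"
          using su by (simp add: algebra_simps)
        then show ?thesis
          using adjoint_clauses(2)[OF B, of u "X n"]
          by (simp add: inner_diff_left inner_add_left)
      qed
      moreover have "u \<bullet> B (X n) \<le> 1 / 2 * (norm u)\<^sup>2 + 1 / 2 * (norm (B (X n) - b))\<^sup>2 + u \<bullet> b"
      proof -
        have "0 \<le> (norm (u - (B (X n) - b)))\<^sup>2"
          by simp
        also have "\<dots> = (norm u)\<^sup>2 + (norm (B (X n) - b))\<^sup>2 - 2 * (u \<bullet> (B (X n) - b))"
          unfolding power2_norm_eq_inner inner_diff_left inner_diff_right
          by (simp add: inner_commute)
        finally show ?thesis
          by (simp add: inner_diff_right)
      qed
      ultimately have "c * (w \<bullet> X n) \<le> C + k + 1 / 2 * (norm u)\<^sup>2 + u \<bullet> b"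
        by (simp add: reg_lsq_def)
      then show ?thesis
        using c by (simp add: field_simps)
    qed
    then show "\<exists>C. \<forall>x\<in>range X. w \<bullet> x \<le> C"
      by blast
  qed
  moreover have "continuous_on UNIV (reg_lsq B b 0 v)"
    unfolding reg_lsq_def using linear_continuous_on[of B UNIV] B
    by (intro continuous_intros) (simp add: linear_conv_bounded_linear)
  moreover have "(\<lambda>n. \<epsilon> n / 2 * (norm y)\<^sup>2) \<longlonglongrightarrow> 0" for y :: 'a
  proof -
    have "(\<lambda>n. \<epsilon> n / 2 * (norm y)\<^sup>2) \<longlonglongrightarrow> 0 / 2 * (norm y)\<^sup>2"
      unfolding \<epsilon>_def by (intro tendsto_intros LIMSEQ_inverse_real_of_nat) simp
    then show ?thesis by simp
  qed
  ultimately show ?thesis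
    using min by (intro minimizer_of_bounded_minimizing_seq[OF proper lsc])
qed

section \<open>The range of the subdifferential is nearly convex\<close>

text \<open>With \<open>B = 0\<close> the existence result yields a minimizer of \<open>f x - v \<bullet> x\<close>, and there \<open>v\<close> is a
  subgradient.\<close>

lemma rel_interior_dom_conjugate_subset:
  fixes f :: "'a::euclidean_space \<Rightarrow> ereal"
  assumes "proper_fun f" and "lsc_fun f" and "convex_fun f"
  shows "rel_interior {s. conjugate f s < \<infinity>} \<subseteq> op_ran (subdifferential f)"
proof
  fix v
  assume v: "v \<in> rel_interior {s. conjugate f s < \<infinity>}"
  have lin: "linear (\<lambda>x::'a. 0::'a)"
    by (rule module_hom_zero)
  have "range (adjoint (\<lambda>x::'a. 0::'a)) = 0"
    by (auto simp: adjoint_zero set_zero)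
  then obtain x where "\<forall>y. f x + ereal (reg_lsq (\<lambda>x. 0::'a) 0 0 v x)
      \<le> f y + ereal (reg_lsq (\<lambda>x. 0::'a) 0 0 v y)"
    using minimizer_exists_if_rel_interior[OF assms lin, of v 0] v by auto
  then have "v \<in> subdifferential f x"
    using minimizer_reg_lsq_iff[OF assms(1,3) lin, of 0 x 0 v] by (simp add: adjoint_zero)
  then show "v \<in> op_ran (subdifferential f)"
    by (auto simp: op_ran_def)
qed

text \<open>All sets between the relative interior of a convex set and the set itself have the same affine
  hull, so their relative interiors are comparable.\<close>

lemma rel_interior_nearly_convex:
  fixes D :: "'a::euclidean_space set"
  assumes D: "convex D" and lower: "rel_interior D \<subseteq> S" and upper: "S \<subseteq> D"
  shows "rel_interior S = rel_interior D"
proof -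
  have "affine hull S = affine hull D"
    using rel_interior_same_affine_hull[OF D] hull_mono[OF lower, of affine] hull_mono[OF upper, of affine]
    by blast
  then have "rel_interior S \<subseteq> rel_interior D" "rel_interior (rel_interior D) \<subseteq> rel_interior S"
    using subset_rel_interior[OF upper] subset_rel_interior[OF lower]
      rel_interior_same_affine_hull[OF D] by auto
  then show ?thesis
    using rel_interior_rel_interior[OF D] by blast
qed

lemma rel_interior_op_ran_subdifferential:
  fixes f :: "'a::euclidean_space \<Rightarrow> ereal"
  assumes "proper_fun f" and "lsc_fun f" and "convex_fun f"
  shows "rel_interior (op_ran (subdifferential f)) = rel_interior {s. conjugate f s < \<infinity>}"
  by (intro rel_interior_nearly_convex convex_dom_conjugate rel_interior_dom_conjugate_subset
      op_ran_subdifferential_subset assms)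

text \<open>Adding a subspace preserves near convexity, so the sum rule for relative interiors of convex
  sets, applied to the domain of the conjugate, transfers to the range of the subdifferential, which
  itself need not be convex.\<close>

lemma rel_interior_op_ran_subdifferential_plus:
  fixes f :: "'a::euclidean_space \<Rightarrow> ereal"
  assumes f: "proper_fun f" "lsc_fun f" "convex_fun f" and L: "subspace L"
  shows "rel_interior (op_ran (subdifferential f) + L) = rel_interior {s. conjugate f s < \<infinity>} + L"
    and "rel_interior (op_ran (subdifferential f) + L) = rel_interior ({s. conjugate f s < \<infinity>} + L)"
proof -
  let ?D = "{s. conjugate f s < \<infinity>}"
  have D: "convex ?D"
    using convex_dom_conjugate[OF f(1)] .
  have L': "convex L" "rel_interior L = L"
    using L subspace_imp_convex subspace_imp_affine rel_interior_affine by auto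
  have sum: "rel_interior (?D + L) = rel_interior ?D + L"
    using rel_interior_sum[OF D L'(1)] L'(2) by simp
  show eq: "rel_interior (op_ran (subdifferential f) + L) = rel_interior (?D + L)"
  proof (rule rel_interior_nearly_convex)
    show "convex (?D + L)"
      using convex_set_plus D L'(1) by blast
    show "rel_interior (?D + L) \<subseteq> op_ran (subdifferential f) + L"
      unfolding sum by (intro set_plus_mono2 rel_interior_dom_conjugate_subset f subset_refl)
    show "op_ran (subdifferential f) + L \<subseteq> ?D + L"
      by (intro set_plus_mono2 op_ran_subdifferential_subset f(1) subset_refl)
  qed
  show "rel_interior (op_ran (subdifferential f) + L) = rel_interior ?D + L"
    using eq sum by simp
qed

section \<open>The least squares problem\<close>

lemma mem_minimizers_iff:
  fixes f :: "real^'n \<Rightarrow> ereal" and A :: "real^'n^'m"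
  assumes "proper_fun f" and "convex_fun f"
  shows "x \<in> minimizers f A b \<longleftrightarrow> transpose A *v (b - A *v x) \<in> subdifferential f x"
  using minimizer_reg_lsq_iff[OF assms matrix_vector_mul_linear[of A], of 0 x b 0]
  by (simp add: minimizers_def is_arg_min_def reg_lsq_def adjoint_matrix not_less)

lemma mem_op_inv_sum_iff:
  fixes A :: "real^'n^'m"
  shows "transpose A *v b \<in> (F +\<^sub>o mat_op (transpose A ** A)) x
    \<longleftrightarrow> transpose A *v (b - A *v x) \<in> F x"
proof -
  have "transpose A *v b = p + transpose A ** A *v x \<longleftrightarrow> p = transpose A *v (b - A *v x)" for p
    by (auto simp: matrix_vector_mult_diff_distrib matrix_vector_mul_assoc)
  then show ?thesis
    by (auto simp: op_add_def mat_op_def)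
qed

text \<open>Both sides describe the points that satisfy the first order condition.\<close>

lemma solution_op_eq_minimizers:
  fixes f :: "real^'n \<Rightarrow> ereal" and A :: "real^'n^'m"
  assumes "proper_fun f" and "convex_fun f"
  shows "solution_op f A = minimizers f A"
  unfolding fun_eq_iff set_eq_iff mem_minimizers_iff[OF assms]
  by (simp add: solution_op_def op_comp_def mat_op_def[of "transpose A"] op_inv_def
      mem_op_inv_sum_iff del: transpose_matrix_vector)

lemma mem_ran_parallel_comp_iff:
  fixes A :: "real^'n^'m"
  shows "b \<in> op_ran (mat_op (mat 1) +\<^sub>o parallel_comp A F)
    \<longleftrightarrow> (\<exists>x. transpose A *v (b - A *v x) \<in> F x)"
proof -
  have "b \<in> op_ran (mat_op (mat 1) +\<^sub>o parallel_comp A F)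
    \<longleftrightarrow> (\<exists>u v x. b = u + v \<and> transpose A *v v \<in> F x \<and> u = A *v x)"
    by (auto simp: op_ran_def op_add_def parallel_comp_def op_comp_def op_inv_def mat_op_def)
  also have "\<dots> \<longleftrightarrow> (\<exists>x. transpose A *v (b - A *v x) \<in> F x)"
    by (metis add.commute add_diff_cancel_right' diff_add_cancel)
  finally show ?thesis .
qed

lemma mem_comp_conjugate_iff:
  fixes A :: "real^'n^'m"
  shows "u \<in> (mat_op A \<circ>\<^sub>o F \<circ>\<^sub>o mat_op (transpose A)) y
    \<longleftrightarrow> (\<exists>x. x \<in> F (transpose A *v y) \<and> u = A *v x)"
  by (auto simp: op_comp_def mat_op_def)

text \<open>For a maximally monotone \<open>M = A \<circ> \<partial>f\<^sup>* \<circ> A\<^sup>T\<close>, the inclusion in the monotone operator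
  \<open>\<partial>(f\<^sup>* \<circ> A\<^sup>T)\<close> is an equality, so the resolvent of \<open>M\<close> is that of a proper lower
  semicontinuous convex function and is total. Here \<open>b - y = A x\<close> with \<open>x \<in> \<partial>f\<^sup>* (A\<^sup>T y)\<close> is the
  stationarity of \<open>x\<close> for the right-hand side \<open>b\<close>, since \<open>\<partial>f\<^sup>*\<close> inverts \<open>\<partial>f\<close>.\<close>

lemma maximally_monotone_comp_iff:
  fixes f :: "real^'n \<Rightarrow> ereal" and A :: "real^'n^'m"
  assumes f: "proper_fun f" "lsc_fun f" "convex_fun f"
  defines "M \<equiv> mat_op A \<circ>\<^sub>o subdifferential (conjugate f) \<circ>\<^sub>o mat_op (transpose A)"
  shows "maximally_monotone M \<longleftrightarrow> (\<forall>b. \<exists>x. transpose A *v (b - A *v x) \<in> subdifferential f x)"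
proof -
  have M: "u \<in> M y \<longleftrightarrow> (\<exists>x. x \<in> subdifferential (conjugate f) (transpose A *v y) \<and> u = A *v x)" for u y
    unfolding M_def by (rule mem_comp_conjugate_iff)
  have adj: "(A *v x) \<bullet> y = x \<bullet> (transpose A *v y)" for x y
    by (metis adjoint_matrix adjoint_works matrix_vector_mul_linear)
  have conj: "proper_fun (conjugate f)"
    by (rule proper_conjugate[OF f])
  have resolvent: "(\<exists>y. b - y \<in> M y) \<longleftrightarrow> (\<exists>x. transpose A *v (b - A *v x) \<in> subdifferential f x)" for b
    unfolding M subdifferential_conjugate_iff[OF f]
    by (metis diff_diff_eq2 add_diff_cancel_left')
  show ?thesis
  proof
    assume total: "\<forall>b. \<exists>x. transpose A *v (b - A *v x) \<in> subdifferential f x"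
    have "monotone_op M"
      unfolding monotone_op_def
    proof (intro allI ballI)
      fix y z u w
      assume "u \<in> M y" "w \<in> M z"
      then obtain p r where p: "p \<in> subdifferential (conjugate f) (transpose A *v y)" "u = A *v p"
        and r: "r \<in> subdifferential (conjugate f) (transpose A *v z)" "w = A *v r"
        unfolding M by blast
      have "0 \<le> (transpose A *v y - transpose A *v z) \<bullet> (p - r)"
        using monotone_subdifferential[OF conj] p(1) r(1) unfolding monotone_op_def by blast
      also have "\<dots> = (y - z) \<bullet> (u - w)"
        using adj[of "p - r" "y - z"] unfolding p(2) r(2)
        by (simp only: matrix_vector_mult_diff_distrib inner_commute)
      finally show "0 \<le> (y - z) \<bullet> (u - w)" .
    qed
    then show "maximally_monotone M"
      using total resolvent by (intro maximally_monotone_if_resolvent_total) auto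
  next
    assume max: "maximally_monotone M"
    define g where "g y = conjugate f (transpose A *v y)" for y
    have "M y \<subseteq> subdifferential g y" for y
      by (auto simp: M subdifferential_def g_def adj matrix_vector_mult_diff_distrib)
    moreover have g: "proper_fun g"
    proof -
      obtain y x where "x \<in> subdifferential (conjugate f) (transpose A *v y)"
        using maximally_monotone_nonempty[OF max] M by blast
      then obtain c where "g y = ereal c"
        using subdifferential_finite[OF conj] unfolding g_def by blast
      then show ?thesis
        using conj unfolding proper_fun_def g_def by (metis PInfty_neq_ereal(1))
    qed
    ultimately have "subdifferential g = M"
      using max monotone_subdifferential unfolding maximally_monotone_def by blast
    moreover have "lsc_fun g"
      unfolding g_def by (intro lsc_conjugate_linear f(1) matrix_vector_mul_linear)
    moreover have "convex_fun g"
      using convex_conjugate[OF f(1)]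
      by (simp add: convex_fun_def g_def matrix_vector_right_distrib matrix_vector_mult_scaleR)
    ultimately show "\<forall>b. \<exists>x. transpose A *v (b - A *v x) \<in> subdifferential f x"
      using subdifferential_resolvent_total[OF g] resolvent by auto
  qed
qed

theorem theorem2p5:
  fixes f :: "real^'n \<Rightarrow> ereal" and A :: "real^'n^'m"
  assumes "proper_fun f" and "lsc_fun f" and "convex_fun f"
  shows
    "op_dom (solution_op f A) = op_ran (mat_op (mat 1) +\<^sub>o parallel_comp A (subdifferential f)) \<and>
     ((\<forall>b. minimizers f A b \<noteq> {}) \<longleftrightarrow>
       op_dom (solution_op f A) = op_ran (mat_op (mat 1) +\<^sub>o parallel_comp A (subdifferential f)) \<and>
       op_ran (mat_op (mat 1) +\<^sub>o parallel_comp A (subdifferential f)) = UNIV) \<and>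
     ((\<forall>b. minimizers f A b \<noteq> {}) \<longleftrightarrow>
       op_ran (subdifferential f +\<^sub>o mat_op (transpose A ** A)) \<supseteq> op_ran (mat_op (transpose A))) \<and>
     ((\<forall>b. minimizers f A b \<noteq> {}) \<longleftrightarrow>
       maximally_monotone
         (mat_op A \<circ>\<^sub>o subdifferential (conjugate f) \<circ>\<^sub>o mat_op (transpose A))) \<and>
     (0 \<in> rel_interior
            {u - v | u v. u \<in> op_ran (subdifferential f) \<and> v \<in> op_ran (mat_op (transpose A))} \<longleftrightarrow>
       rel_interior (op_ran (subdifferential f)) \<inter> op_ran (mat_op (transpose A)) \<noteq> {}) \<and>
     (0 \<in> rel_interior
            {u - v | u v. u \<in> op_ran (subdifferential f) \<and> v \<in> op_ran (mat_op (transpose A))} \<longrightarrow>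
       (\<forall>b. minimizers f A b \<noteq> {})) \<and>
     (0 \<in> rel_interior (op_ran (subdifferential f)) \<longrightarrow>
       (\<forall>b. minimizers f A b \<noteq> {}))"
proof -
  define S where "S = op_ran (subdifferential f)"
  define L where "L = op_ran (mat_op (transpose A))"
  define D where "D = {s. conjugate f s < \<infinity>}"
  define solvable where
    "solvable b \<longleftrightarrow> (\<exists>x. transpose A *v (b - A *v x) \<in> subdifferential f x)" for b
  have minimizers: "minimizers f A b \<noteq> {} \<longleftrightarrow> solvable b" for b
    using mem_minimizers_iff[OF assms(1,3)] by (auto simp: solvable_def)
  have dom: "op_dom (solution_op f A) = {b. solvable b}"
    using minimizers solution_op_eq_minimizers[OF assms(1,3), of A] by (simp add: op_dom_def)
  have ran: "op_ran (mat_op (mat 1) +\<^sub>o parallel_comp A (subdifferential f)) = {b. solvable b}"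
    by (auto simp: mem_ran_parallel_comp_iff solvable_def)
  have ii: "op_ran (subdifferential f +\<^sub>o mat_op (transpose A ** A)) \<supseteq> L \<longleftrightarrow> (\<forall>b. solvable b)"
  proof -
    have "L = range (\<lambda>b. transpose A *v b)"
      by (auto simp: L_def op_ran_def mat_op_def)
    then have "op_ran (subdifferential f +\<^sub>o mat_op (transpose A ** A)) \<supseteq> L \<longleftrightarrow>
        (\<forall>b. \<exists>x. transpose A *v b \<in> (subdifferential f +\<^sub>o mat_op (transpose A ** A)) x)"
      unfolding op_ran_def by blast
    then show ?thesis
      unfolding mem_op_inv_sum_iff solvable_def .
  qed
  have L_adj: "L = range (adjoint ((*v) A))"
    by (auto simp: L_def op_ran_def mat_op_def adjoint_matrix)
  have L: "subspace L"
    unfolding L_adj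
    by (intro linear_subspace_image adjoint_linear matrix_vector_mul_linear subspace_UNIV)
  have diff: "{u - v | u v. u \<in> S \<and> v \<in> L} = S + L"
  proof (intro equalityI subsetI)
    fix x
    assume "x \<in> {u - v | u v. u \<in> S \<and> v \<in> L}"
    then obtain u v where x: "x = u + - v" "u \<in> S" "v \<in> L"
      by auto
    then show "x \<in> S + L"
      using subspace_neg[OF L] by (simp only: set_plus_intro)
  next
    fix x
    assume "x \<in> S + L"
    then obtain u v where x: "x = u - (- v)" "u \<in> S" "v \<in> L"
      by (auto elim: set_plus_elim)
    then show "x \<in> {u - v | u v. u \<in> S \<and> v \<in> L}"
      using subspace_neg[OF L] by blast
  qed
  note ri = rel_interior_op_ran_subdifferential_plus[OF assms L, folded S_def D_def]
  have equiv: "0 \<in> rel_interior (S + L) \<longleftrightarrow> rel_interior S \<inter> L \<noteq> {}"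
  proof -
    have "0 \<in> rel_interior D + L \<longleftrightarrow> rel_interior D \<inter> L \<noteq> {}"
    proof
      assume "0 \<in> rel_interior D + L"
      then obtain u v where uv: "u \<in> rel_interior D" "v \<in> L" "0 = u + v"
        by (auto elim: set_plus_elim)
      then have "u = - v"
        by (simp add: eq_neg_iff_add_eq_0)
      then show "rel_interior D \<inter> L \<noteq> {}"
        using uv subspace_neg[OF L] by auto
    next
      assume "rel_interior D \<inter> L \<noteq> {}"
      then obtain u where u: "u \<in> rel_interior D" "u \<in> L"
        by blast
      then have "u + - u \<in> rel_interior D + L"
        using subspace_neg[OF L] by (intro set_plus_intro)
      then show "0 \<in> rel_interior D + L"
        by simp
    qed
    then show ?thesis
      using ri(1) rel_interior_op_ran_subdifferential[OF assms] by (simp add: S_def D_def)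
  qed
  have iv: "solvable b" if "0 \<in> rel_interior (S + L)" for b
  proof -
    have "0 \<in> rel_interior (D + L)"
      using that ri(2) by simp
    then have "\<exists>x. \<forall>y. f x + ereal (reg_lsq ((*v) A) b 0 0 x) \<le> f y + ereal (reg_lsq ((*v) A) b 0 0 y)"
      unfolding D_def L_adj
      by (rule minimizer_exists_if_rel_interior[OF assms matrix_vector_mul_linear])
    then obtain x where
      "\<forall>y. f x + ereal (reg_lsq ((*v) A) b 0 0 x) \<le> f y + ereal (reg_lsq ((*v) A) b 0 0 y)" ..
    then have "0 + adjoint ((*v) A) (b - A *v x) - 0 *\<^sub>R x \<in> subdifferential f x"
      by (rule minimizer_reg_lsq_iff[OF assms(1,3) matrix_vector_mul_linear[of A] order_refl,
            THEN iffD1])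
    then show ?thesis
      by (auto simp: solvable_def adjoint_matrix)
  qed
  have v: "solvable b" if "0 \<in> rel_interior S" for b
    using iv equiv that subspace_0[OF L] by blast
  have iii: "maximally_monotone (mat_op A \<circ>\<^sub>o subdifferential (conjugate f) \<circ>\<^sub>o mat_op (transpose A))
      \<longleftrightarrow> (\<forall>b. solvable b)"
    unfolding solvable_def by (rule maximally_monotone_comp_iff[OF assms])
  show ?thesis
    unfolding S_def[symmetric] L_def[symmetric] dom ran minimizers diff ii iii
    using equiv iv v by blast
qed

end
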